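(* Let $\mathcal{G}$ be a connected $d$-regular undirected graph on $\{1,\dots,N\}$ with $d\ge1$, and let $\lambda$ be the growth rate of the recursion $$x_i(t+1)=\max\Big(x_i(t),\ \max_{j\in\mathcal{N}_i}\big(x_j(t)+v_{ij}(t)\big)\Big),$$ where the noise samples $v_{ij}(t)$ are i.i.d. with zero mean, CDF $F$ and PDF $f$. Then $$\lambda\ \ge\ m_+(d)=d\int_0^\infty x\,F^{d-1}(x)f(x)\,dx,$$ where $m_+(d)=\mathbb{E}[\max(0,V_1,\dots,V_d)]$ for $V_1,\dots,V_d$ i.i.d. with the noise distribution.
   Context: $\mathcal{N}_i$ is the set of neighbors of node $i$. The noise samples $v_{ij}(t)$, indexed by ordered pairs $(i,j)$ of adjacent nodes and times $t=0,1,2,\dots$, are i.i.d. real random variables with zero mean. Initial values $x_1(0),\dots,x_N(0)$ are arbitrary fixed real numbers. The growth rate $\lambda$ is the real constant, known to exist and to be independent of $i$ and of the initial values, such that $\lambda=\lim_{t\to\infty}x_i(t)/t$ almost surely and $\lambda=\lim_{t\to\infty}\mathbb{E}[x_i(t)]/t$ for all $i$. *)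

theory Defs
  imports
    "Graph_Theory.Pair_Digraph"
    "Graph_Theory.Digraph_Component"
    "HOL-Probability.Probability"
begin

text \<open>A finite simple undirected graph is a \<open>pair_graph\<close>: a finite, loop-free, symmetric set of
  ordered pairs \<open>parcs G\<close> over the vertex set \<open>pverts G\<close>. So \<open>parcs G\<close> is exactly the set of
  ordered pairs of adjacent nodes.\<close>

definition neighbors :: "'v pair_pre_digraph \<Rightarrow> 'v \<Rightarrow> 'v set" where
  "neighbors G i = {j. (i, j) \<in> parcs G}"

definition regular_graph :: "'v pair_pre_digraph \<Rightarrow> nat \<Rightarrow> bool" where
  "regular_graph G d \<longleftrightarrow> (\<forall>i\<in>pverts G. card (neighbors G i) = d)"

text \<open>The inner \<open>Max\<close> is only meaningful for nodes with a nonempty finite set of neighbors,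
  which is the case for all vertices of a \<open>d\<close>-regular finite graph with \<open>d \<ge> 1\<close>.\<close>

primrec max_process ::
  "'v pair_pre_digraph \<Rightarrow> ('v \<Rightarrow> real) \<Rightarrow> ('v \<Rightarrow> 'v \<Rightarrow> nat \<Rightarrow> 'a \<Rightarrow> real) \<Rightarrow> nat \<Rightarrow> 'v \<Rightarrow> 'a \<Rightarrow> real"
where
  "max_process G x0 v 0 = (\<lambda>i \<omega>. x0 i)"
| "max_process G x0 v (Suc t) = (\<lambda>i \<omega>. max (max_process G x0 v t i \<omega>)
      (Max ((\<lambda>j. max_process G x0 v t j \<omega> + v i j t \<omega>) ` neighbors G i)))"

definition growth_rate ::
  "'a measure \<Rightarrow> 'v set \<Rightarrow> (nat \<Rightarrow> 'v \<Rightarrow> 'a \<Rightarrow> real) \<Rightarrow> real \<Rightarrow> bool"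
where
  "growth_rate M I x l \<longleftrightarrow> (\<forall>i\<in>I.
      (AE \<omega> in M. (\<lambda>t. x t i \<omega> / real t) \<longlonglongrightarrow> l) \<and>
      (\<lambda>t. (\<integral>\<omega>. x t i \<omega> \<partial>M) / real t) \<longlonglongrightarrow> l)"

text \<open>\<open>E[max(0, V_1, \<dots>, V_d)]\<close> for i.i.d. \<open>V_k\<close> of law \<open>\<mu>\<close>, realised as the coordinates of the
  \<open>d\<close>-fold product measure.\<close>

definition m_plus :: "real measure \<Rightarrow> nat \<Rightarrow> real" where
  "m_plus \<mu> d = (\<integral>V. Max (insert 0 (V ` {1..d})) \<partial>(\<Pi>\<^sub>M k\<in>{1..d}. \<mu>))"

end

(* Let p be the probability that a given one of d i.i.d. noise variables is nonnegative and exceeds the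
   others, and q the expectation of that variable on this event. The law has no atoms, so almost
   surely either all d variables are negative, with probability 1 - d p, or exactly one of them wins
   in this sense; hence E[max(0, V_1, ..., V_d)] = d q, and conditioning on V_k turns q into the
   stated integral.
   Selecting the winner's term regardless of the current state x(t) bounds the maximum from below,
   and the current noise is independent of x(t), so
     E x_i(t+1) >= (1 - d p) E x_i(t) + (sum over neighbors j of i) (p E x_j(t) + q).
   Summing over i, d-regularity makes the coefficient of every E x_i(t) equal to 1: the total
   expectation grows by at least N d q per step. *)

theory Submission
  imports Defs
begin

section \<open>Pointwise decomposition by the winning index\<close>

text \<open>Strict comparison with the other entries makes the winner unique without a tie-breaking
  order. On a tie at the top nobody wins, which costs only a null set when the law has no
  atoms.\<close>

definition wins :: "'i set \<Rightarrow> 'i \<Rightarrow> ('i \<Rightarrow> real) \<Rightarrow> bool" where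
  "wins I j w \<longleftrightarrow> 0 \<le> w j \<and> (\<forall>k\<in>I - {j}. w k < w j)"

lemma sum_of_bool_unique:
  fixes c :: "'i \<Rightarrow> real"
  assumes "finite I" "j \<in> I" "P j" "\<And>k. k \<in> I \<Longrightarrow> k \<noteq> j \<Longrightarrow> \<not> P k"
  shows "(\<Sum>k\<in>I. c k * of_bool (P k)) = c j"
proof -
  have "(\<Sum>k\<in>I. c k * of_bool (P k)) = (\<Sum>k\<in>I. if k = j then c j else 0)"
    using assms by (intro sum.cong) auto
  then show ?thesis using assms by simp
qed

text \<open>Injectivity upgrades the weak bound by the maximum to a strict one at its position, so a
  nonnegative maximum has exactly one winner. The case \<open>one\<close> also records that the
  winner dominates all entries, to spare later proofs the unfolding.\<close>

lemma winner_cases: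
  assumes I: "finite I" "I \<noteq> {}" and no_tie: "inj_on w I"
  obtains (none) "\<forall>k\<in>I. w k < 0" "\<And>k. k \<in> I \<Longrightarrow> \<not> wins I k w"
  | (one) j where "j \<in> I" "wins I j w" "\<And>k. k \<in> I \<Longrightarrow> k \<noteq> j \<Longrightarrow> \<not> wins I k w" "\<exists>k\<in>I. 0 \<le> w k"
      "\<And>k. k \<in> I \<Longrightarrow> w k \<le> w j"
proof (cases "\<forall>k\<in>I. w k < 0")
  case True
  then show ?thesis by (intro none) (auto simp: wins_def not_le)
next
  case False
  then obtain k where k: "k \<in> I" "0 \<le> w k" by force
  have "Max (w ` I) \<in> w ` I" using I by (intro Max_in) auto
  then obtain j where j: "j \<in> I" "w j = Max (w ` I)" by force
  have le: "w l \<le> w j" if "l \<in> I" for l using j that I by simp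
  have "w l < w j" if "l \<in> I - {j}" for l
    using le[of l] that inj_onD[OF no_tie _ _ j(1), of l] by force
  then have "wins I j w" using le[OF k(1)] k by (auto simp: wins_def)
  moreover have "\<not> wins I l w" if "l \<in> I" "l \<noteq> j" for l
    using le[OF that(1)] that j(1) unfolding wins_def by (metis DiffI not_less singletonD)
  ultimately show ?thesis using j(1) k le by (intro one) auto
qed

lemma winner_weights_sum:
  assumes "finite I" "I \<noteq> {}" "inj_on w I"
  shows "of_bool (\<forall>k\<in>I. w k < 0) + (\<Sum>j\<in>I. of_bool (wins I j w)) = (1 :: real)"
  using assms
proof (cases rule: winner_cases)
  case none
  then show ?thesis by auto
next
  case (one j)
  then show ?thesis
    using sum_of_bool_unique[of I j "\<lambda>j. wins I j w" "\<lambda>_. 1"] assms(1) by (simp add: not_less)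
qed

text \<open>When all entries are negative both sides vanish; otherwise the sum collapses to the
  winner's entry, which is the maximum and is nonnegative.\<close>

lemma Max_eq_winner_sum:
  assumes "finite I" "I \<noteq> {}" "inj_on w I"
  shows "Max (insert 0 (w ` I)) = (\<Sum>j\<in>I. w j * of_bool (wins I j w))"
  using assms
proof (cases rule: winner_cases)
  case none
  then have "Max (insert 0 (w ` I)) = 0" using assms(1) by (intro Max_eqI) auto
  then show ?thesis using none by simp
next
  case (one j)
  then have "Max (insert 0 (w ` I)) = w j"
    using assms(1) by (intro Max_eqI) (auto simp: wins_def)
  then show ?thesis using one sum_of_bool_unique[of I j "\<lambda>j. wins I j w" w] assms(1) by simp
qed

text \<open>The left side selects exactly one of \<open>a\<close> and the \<open>b j\<close>, and
  any selected term is at most the maximum. The selection looks at \<open>w\<close> alone, while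
  \<open>b\<close> is arbitrary; later \<open>w\<close> is the noise and \<open>b\<close> is state
  plus noise.\<close>

lemma max_ge_winner_sum:
  fixes b w :: "'i \<Rightarrow> real"
  assumes "finite I" "I \<noteq> {}" "inj_on w I"
  shows "a * of_bool (\<forall>k\<in>I. w k < 0) + (\<Sum>j\<in>I. b j * of_bool (wins I j w)) \<le> max a (Max (b ` I))"
  using assms
proof (cases rule: winner_cases)
  case none
  then show ?thesis by simp
next
  case (one j)
  then show ?thesis
    using sum_of_bool_unique[of I j "\<lambda>j. wins I j w" b] assms(1)
    by (simp add: max.coboundedI2) (meson not_less)
qed

section \<open>Finite powers of an atomless law and the winner's statistics\<close>

text \<open>Absence of atoms serves twice: ties between independent samples are null, and strict and
  weak upper bounds have the same probability, so that \<open>cdf\<close> measures the event of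
  being strictly beaten.\<close>

locale atomless_law = real_distribution \<mu> for \<mu> +
  assumes atomless: "measure \<mu> {x} = 0"
begin

sublocale power: product_prob_space "\<lambda>_::'i. \<mu>" I for I :: "'i set" ..

lemma measurable_component:
  "j \<in> I \<Longrightarrow> (\<lambda>w. w j) \<in> borel_measurable (\<Pi>\<^sub>M k\<in>I. \<mu>)"
  using measurable_component_singleton[of j I "\<lambda>_. \<mu>"] by simp

lemma measurable_wins [measurable]:
  assumes [simp]: "finite I" and [measurable]: "j \<in> I"
  shows "Measurable.pred (\<Pi>\<^sub>M k\<in>I. \<mu>) (wins I j)"
proof -
  have [measurable]: "\<And>k. k \<in> I - {j} \<Longrightarrow> (\<lambda>w. w k) \<in> borel_measurable (\<Pi>\<^sub>M k\<in>I. \<mu>)"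
    by (auto intro: measurable_component)
  have [measurable]: "(\<lambda>w. w j) \<in> borel_measurable (\<Pi>\<^sub>M k\<in>I. \<mu>)"
    using assms by (auto intro: measurable_component)
  have "finite (I - {j})" by simp
  then show ?thesis unfolding wins_def by measurable
qed

lemma measurable_all_neg [measurable]:
  assumes "finite I"
  shows "Measurable.pred (\<Pi>\<^sub>M k\<in>I. \<mu>) (\<lambda>w. \<forall>k\<in>I. w k < 0)"
proof -
  have [measurable]: "\<And>k. k \<in> I \<Longrightarrow> (\<lambda>w. w k) \<in> borel_measurable (\<Pi>\<^sub>M k\<in>I. \<mu>)"
    by (rule measurable_component)
  show ?thesis using assms by measurable
qed

text \<open>This separates one coordinate from the others, so that Fubini applies; it underlies both
  the absence of ties and the conditioning on the winner's value.\<close>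

lemma distr_insert:
  "distr (\<mu> \<Otimes>\<^sub>M (\<Pi>\<^sub>M k\<in>J. \<mu>)) (\<Pi>\<^sub>M k\<in>insert j J. \<mu>) (\<lambda>(x, w). w(j := x)) = (\<Pi>\<^sub>M k\<in>insert j J. \<mu>)"
  using distr_pair_PiM_eq_PiM[of J "\<lambda>_. \<mu>" j] prob_space_axioms by simp

lemma measurable_upd:
  "(\<lambda>(x, w). w(j := x)) \<in> (\<mu> \<Otimes>\<^sub>M (\<Pi>\<^sub>M k\<in>J. \<mu>)) \<rightarrow>\<^sub>M (\<Pi>\<^sub>M k\<in>insert j J. \<mu>)"
  using measurable_compose[OF measurable_pair_swap' measurable_add_dim[of j J "\<lambda>_. \<mu>"]]
  by (simp add: split_beta')

lemma AE_not_atom: "AE x in \<mu>. x \<noteq> y"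
proof -
  have "{y} \<in> null_sets \<mu>" using atomless[of y] by (auto simp: null_sets_def emeasure_eq_measure)
  then have "AE x in \<mu>. x \<notin> {y}" by (rule AE_not_in)
  then show ?thesis by simp
qed

text \<open>Once coordinate \<open>j\<close> is frozen at a value \<open>x\<close>, coordinate
  \<open>k\<close> still has an atomless law and almost surely avoids \<open>x\<close>. Fubini then
  removes the freezing.\<close>

lemma AE_no_tie:
  assumes I: "finite I" "j \<in> I" "k \<in> I" "j \<noteq> k"
  shows "AE w in (\<Pi>\<^sub>M k\<in>I. \<mu>). w j \<noteq> w k"
proof -
  define J where "J = I - {j}"
  have J: "insert j J = I" "k \<in> J" "j \<notin> J" using I by (auto simp: J_def)
  have [measurable]: "j \<in> I" "k \<in> I" "k \<in> J" using I J by auto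
  interpret pair_sigma_finite \<mu> "\<Pi>\<^sub>M k\<in>J. \<mu>" ..
  have inner: "AE w in (\<Pi>\<^sub>M k\<in>J. \<mu>). x \<noteq> w k" for x
  proof -
    have "AE w in (\<Pi>\<^sub>M k\<in>J. \<mu>). w k \<noteq> x"
      by (rule AE_PiM_component[OF prob_space_axioms J(2) AE_not_atom])
    then show ?thesis by eventually_elim simp
  qed
  have coord: "(\<lambda>p. snd p k) \<in> borel_measurable (\<mu> \<Otimes>\<^sub>M (\<Pi>\<^sub>M k\<in>J. \<mu>))"
    by (rule measurable_compose[OF measurable_snd measurable_component[OF J(2)]])
  have "{p \<in> space (\<mu> \<Otimes>\<^sub>M (\<Pi>\<^sub>M k\<in>J. \<mu>)). fst p \<noteq> snd p k} \<in> sets (\<mu> \<Otimes>\<^sub>M (\<Pi>\<^sub>M k\<in>J. \<mu>))"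
    using coord by (intro borel_measurable_neq) auto
  then have "AE p in \<mu> \<Otimes>\<^sub>M (\<Pi>\<^sub>M k\<in>J. \<mu>). fst p \<noteq> snd p k"
    by (rule AE_pair_measure) (simp add: inner)
  then have "AE p in \<mu> \<Otimes>\<^sub>M (\<Pi>\<^sub>M k\<in>J. \<mu>). ((case p of (x, w) \<Rightarrow> w(j := x)) j \<noteq> (case p of (x, w) \<Rightarrow> w(j := x)) k)"
    by eventually_elim (use I in \<open>auto simp: split_beta'\<close>)
  then have "AE w in distr (\<mu> \<Otimes>\<^sub>M (\<Pi>\<^sub>M k\<in>J. \<mu>)) (\<Pi>\<^sub>M k\<in>insert j J. \<mu>) (\<lambda>(x, w). w(j := x)). w j \<noteq> w k"
    using measurable_component[of _ I] I
    by (subst AE_distr_iff[OF measurable_upd]) (auto simp: J intro!: borel_measurable_neq)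
  then show ?thesis by (simp only: distr_insert[of J j, unfolded J(1)] J(1))
qed

lemma AE_inj_on:
  assumes I: "finite I"
  shows "AE w in (\<Pi>\<^sub>M k\<in>I. \<mu>). inj_on w I"
proof -
  have "AE w in (\<Pi>\<^sub>M k\<in>I. \<mu>). \<forall>j\<in>I. \<forall>k\<in>I. j \<noteq> k \<longrightarrow> w j \<noteq> w k"
    using I AE_no_tie[OF I] by (intro AE_finite_allI) auto
  then show ?thesis by eventually_elim (auto simp: inj_on_def)
qed

lemma measure_below:
  assumes "finite J"
  shows "measure (\<Pi>\<^sub>M k\<in>J. \<mu>) {w \<in> space (\<Pi>\<^sub>M k\<in>J. \<mu>). \<forall>k\<in>J. w k < x} = cdf \<mu> x ^ card J"
proof -
  have "measure \<mu> ({..<x} \<union> {x}) = measure \<mu> {..<x} + measure \<mu> {x}"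
    by (intro finite_measure_Union) auto
  moreover have "{..<x} \<union> {x} = {..x}" by auto
  ultimately have "measure \<mu> {..<x} = cdf \<mu> x" by (simp add: atomless cdf_def)
  moreover have "measure (\<Pi>\<^sub>M k\<in>J. \<mu>) {w \<in> space (\<Pi>\<^sub>M k\<in>J. \<mu>). \<forall>k\<in>J. w k \<in> {..<x}} = (\<Prod>k\<in>J. measure \<mu> {..<x})"
    using power.emeasure_PiM_Collect[of J J "\<lambda>_. {..<x}"] assms
    by (simp add: power.emeasure_eq_measure emeasure_eq_measure prod_ennreal prod_nonneg measure_nonneg
        ennreal_power)
  ultimately show ?thesis by simp
qed

lemma cdf_measurable [measurable]: "cdf \<mu> \<in> borel_measurable borel"
  by (intro borel_measurable_mono monoI cdf_nondecreasing)

text \<open>Given that coordinate \<open>j\<close> has a value \<open>x \<ge> 0\<close>, it wins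
  exactly when the remaining \<open>card I - 1\<close> independent coordinates lie below
  \<open>x\<close>. A general \<open>h\<close> covers the winning probability (\<open>h\<close>
  constant 1) and the winner's mean (\<open>h\<close> the identity) together.\<close>

lemma integral_wins:
  fixes h :: "real \<Rightarrow> real"
  assumes I: "finite I" "j \<in> I" and h: "integrable \<mu> h"
  shows "(\<integral>w. h (w j) * of_bool (wins I j w) \<partial>(\<Pi>\<^sub>M k\<in>I. \<mu>))
     = (\<integral>x. h x * indicator {0..} x * cdf \<mu> x ^ (card I - 1) \<partial>\<mu>)"
proof -
  define J where "J = I - {j}"
  have J: "insert j J = I" "j \<notin> J" "finite J" "card J = card I - 1" using I by (auto simp: J_def)
  have [measurable]: "j \<in> I" "finite I" "finite J" using I J by auto
  have [measurable]: "h \<in> borel_measurable \<mu>" using h by auto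
  then have [measurable]: "h \<in> borel_measurable borel" by (simp cong: measurable_cong_sets)
  have JP: "prob_space (\<Pi>\<^sub>M k\<in>J. \<mu>)" by unfold_locales
  interpret pair_sigma_finite \<mu> "\<Pi>\<^sub>M k\<in>J. \<mu>" ..
  let ?g = "\<lambda>x w. h x * indicator {0..} x * of_bool (\<forall>k\<in>J. w k < x)"
  have wins_upd: "wins I j (w(j := x)) \<longleftrightarrow> 0 \<le> x \<and> (\<forall>k\<in>J. w k < x)" for x w
    by (auto simp: wins_def J_def)
  have meas: "(\<lambda>(x, w). ?g x w) \<in> borel_measurable (\<mu> \<Otimes>\<^sub>M (\<Pi>\<^sub>M k\<in>J. \<mu>))"
    unfolding of_bool_def by measurable
  \<comment> \<open>The function \<open>h\<close> of the separated coordinate dominates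
    \<open>?g\<close> and supplies the integrability for Fubini.\<close>
  have "integrable (\<mu> \<Otimes>\<^sub>M (\<Pi>\<^sub>M k\<in>J. \<mu>)) (\<lambda>(x, w). h x)"
    using h integrable_distr[of fst "\<mu> \<Otimes>\<^sub>M (\<Pi>\<^sub>M k\<in>J. \<mu>)" \<mu> h]
    by (simp add: prob_space.distr_pair_fst[OF JP] split_beta')
  then have int: "integrable (\<mu> \<Otimes>\<^sub>M (\<Pi>\<^sub>M k\<in>J. \<mu>)) (\<lambda>(x, w). ?g x w)"
    by (rule Bochner_Integration.integrable_bound[OF _ meas]) (auto simp: indicator_def)
  have "(\<integral>w. h (w j) * of_bool (wins I j w) \<partial>(\<Pi>\<^sub>M k\<in>I. \<mu>))
      = (\<integral>w. h (w j) * of_bool (wins I j w) \<partial>(distr (\<mu> \<Otimes>\<^sub>M (\<Pi>\<^sub>M k\<in>J. \<mu>)) (\<Pi>\<^sub>M k\<in>I. \<mu>) (\<lambda>(x, w). w(j := x))))"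
    using distr_insert[of J j] J by simp
  also have "\<dots> = (\<integral>p. (case p of (x, w) \<Rightarrow> ?g x w) \<partial>(\<mu> \<Otimes>\<^sub>M (\<Pi>\<^sub>M k\<in>J. \<mu>)))"
    using measurable_upd[of j J] J unfolding of_bool_def
    by (subst integral_distr) (auto simp: split_beta' wins_upd indicator_def intro!: Bochner_Integration.integral_cong)
  also have "\<dots> = (\<integral>x. (\<integral>w. ?g x w \<partial>(\<Pi>\<^sub>M k\<in>J. \<mu>)) \<partial>\<mu>)"
    using integral_fst'[OF int] by simp
  also have "\<dots> = (\<integral>x. h x * indicator {0..} x * cdf \<mu> x ^ (card I - 1) \<partial>\<mu>)"
  proof (intro Bochner_Integration.integral_cong refl)
    fix x
    have "(\<integral>w. of_bool (\<forall>k\<in>J. w k < x) \<partial>(\<Pi>\<^sub>M k\<in>J. \<mu>)) =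
       (\<integral>w. indicator {w \<in> space (\<Pi>\<^sub>M k\<in>J. \<mu>). \<forall>k\<in>J. w k < x} w \<partial>(\<Pi>\<^sub>M k\<in>J. \<mu>))"
      by (intro Bochner_Integration.integral_cong) (auto simp: indicator_def)
    also have "\<dots> = cdf \<mu> x ^ card J"
      using measure_below[OF J(3), of x] by simp
    finally show "(\<integral>w. ?g x w \<partial>(\<Pi>\<^sub>M k\<in>J. \<mu>)) = h x * indicator {0..} x * cdf \<mu> x ^ (card I - 1)"
      using J by simp
  qed
  finally show ?thesis .
qed

text \<open>This and \<open>win_mean\<close> are the \<open>p\<close> and \<open>q\<close> of the
  opening idea, already conditioned on the winner's value; they depend on the index set through its
  size alone.\<close>

definition win_prob :: "nat \<Rightarrow> real" where
  "win_prob d = (\<integral>x. indicator {0..} x * cdf \<mu> x ^ (d - 1) \<partial>\<mu>)"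

definition win_mean :: "nat \<Rightarrow> real" where
  "win_mean d = (\<integral>x. x * indicator {0..} x * cdf \<mu> x ^ (d - 1) \<partial>\<mu>)"

lemma integral_of_bool_wins:
  assumes "finite I" "j \<in> I"
  shows "(\<integral>w. of_bool (wins I j w) \<partial>(\<Pi>\<^sub>M k\<in>I. \<mu>)) = win_prob (card I)"
  using integral_wins[OF assms, of "\<lambda>_. 1"] by (simp add: win_prob_def)

lemma integrable_of_bool:
  assumes [measurable]: "Measurable.pred (\<Pi>\<^sub>M k\<in>I. \<mu>) P"
  shows "integrable (\<Pi>\<^sub>M k\<in>I. \<mu>) (\<lambda>w. of_bool (P w) :: real)"
  unfolding of_bool_def by (intro power.integrable_const_bound[where B = 1]) auto

text \<open>The weights in \<open>winner_weights_sum\<close> add up to 1 almost everywhere, and each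
  of the \<open>card I\<close> winning events has the same probability.\<close>

lemma integral_all_neg:
  assumes "finite I" "I \<noteq> {}"
  shows "(\<integral>w. of_bool (\<forall>k\<in>I. w k < 0) \<partial>(\<Pi>\<^sub>M k\<in>I. \<mu>)) + card I * win_prob (card I) = 1"
proof -
  have 1: "integrable (\<Pi>\<^sub>M k\<in>I. \<mu>) (\<lambda>w. of_bool (\<forall>k\<in>I. w k < 0) :: real)"
    using assms by (intro integrable_of_bool) measurable
  have 2: "integrable (\<Pi>\<^sub>M k\<in>I. \<mu>) (\<lambda>w. of_bool (wins I j w) :: real)" if "j \<in> I" for j
    using assms that by (intro integrable_of_bool) measurable
  have "(\<integral>w. of_bool (\<forall>k\<in>I. w k < 0) + (\<Sum>j\<in>I. of_bool (wins I j w)) \<partial>(\<Pi>\<^sub>M k\<in>I. \<mu>)) = (\<integral>w. (1::real) \<partial>(\<Pi>\<^sub>M k\<in>I. \<mu>))"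
  proof (rule integral_cong_AE)
    show "(\<lambda>w. of_bool (\<forall>k\<in>I. w k < 0) + (\<Sum>j\<in>I. of_bool (wins I j w)) :: real) \<in> borel_measurable (\<Pi>\<^sub>M k\<in>I. \<mu>)"
      using 1 2 by (intro borel_measurable_add borel_measurable_sum) auto
    show "AE w in (\<Pi>\<^sub>M k\<in>I. \<mu>). of_bool (\<forall>k\<in>I. w k < 0) + (\<Sum>j\<in>I. of_bool (wins I j w)) = (1 :: real)"
      using AE_inj_on[OF assms(1)] by eventually_elim (rule winner_weights_sum[OF assms])
  qed simp
  moreover have "(\<integral>w. of_bool (\<forall>k\<in>I. w k < 0) + (\<Sum>j\<in>I. of_bool (wins I j w)) \<partial>(\<Pi>\<^sub>M k\<in>I. \<mu>))
      = (\<integral>w. of_bool (\<forall>k\<in>I. w k < 0) \<partial>(\<Pi>\<^sub>M k\<in>I. \<mu>)) + (\<Sum>j\<in>I. win_prob (card I))"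
    using 1 2 integral_of_bool_wins[OF assms(1)]
    by (subst Bochner_Integration.integral_add Bochner_Integration.integral_sum;
        auto simp del: sum_of_bool_eq intro!: Bochner_Integration.integrable_sum)+
  ultimately show ?thesis by (simp add: power.P.prob_space)
qed

lemma integrable_coord:
  assumes "integrable \<mu> (\<lambda>x. x)" "j \<in> I"
  shows "integrable (\<Pi>\<^sub>M k\<in>I. \<mu>) (\<lambda>w. w j)"
proof -
  have "integrable (distr (\<Pi>\<^sub>M k\<in>I. \<mu>) \<mu> (\<lambda>w. w j)) (\<lambda>x. x)"
    using power.PiM_component[OF assms(2)] assms by simp
  then show ?thesis using assms(2) by (subst (asm) integrable_distr_eq) auto
qed

lemma integrable_coord_wins:
  assumes "integrable \<mu> (\<lambda>x. x)" "finite I" "j \<in> I"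
  shows "integrable (\<Pi>\<^sub>M k\<in>I. \<mu>) (\<lambda>w. w j * of_bool (wins I j w))"
proof -
  have [measurable]: "finite I" "j \<in> I" using assms by auto
  show ?thesis unfolding of_bool_def
    by (rule Bochner_Integration.integrable_bound[OF integrable_coord[OF assms(1,3)]]) auto
qed

text \<open>Off the null set of ties the maximum is the sum of the winners' contributions, and each
  index contributes \<open>win_mean\<close> by symmetry.\<close>

lemma integral_Max:
  assumes "integrable \<mu> (\<lambda>x. x)" "finite I" "I \<noteq> {}"
  shows "(\<integral>w. Max (insert 0 (w ` I)) \<partial>(\<Pi>\<^sub>M k\<in>I. \<mu>)) = card I * win_mean (card I)"
proof -
  have [measurable]: "finite I" using assms by simp
  have "Max (insert 0 (w ` I)) = max 0 (Max (w ` I))" for w :: "_ \<Rightarrow> real"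
    using assms by (subst Max_insert) auto
  moreover have "(\<lambda>w. Max ((\<lambda>k. w k) ` I)) \<in> borel_measurable (\<Pi>\<^sub>M k\<in>I. \<mu>)"
    using assms by (intro borel_measurable_Max) auto
  ultimately have meas: "(\<lambda>w. Max (insert 0 (w ` I))) \<in> borel_measurable (\<Pi>\<^sub>M k\<in>I. \<mu>)"
    by simp
  have "(\<integral>w. Max (insert 0 (w ` I)) \<partial>(\<Pi>\<^sub>M k\<in>I. \<mu>)) = (\<integral>w. (\<Sum>j\<in>I. w j * of_bool (wins I j w)) \<partial>(\<Pi>\<^sub>M k\<in>I. \<mu>))"
  proof (intro integral_cong_AE meas borel_measurable_sum)
    show "(\<lambda>w. w j * of_bool (wins I j w)) \<in> borel_measurable (\<Pi>\<^sub>M k\<in>I. \<mu>)" if "j \<in> I" for j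
      using integrable_coord_wins[OF assms(1,2) that] by auto
    show "AE w in (\<Pi>\<^sub>M k\<in>I. \<mu>). Max (insert 0 (w ` I)) = (\<Sum>j\<in>I. w j * of_bool (wins I j w))"
      using AE_inj_on[OF assms(2)] by eventually_elim (rule Max_eq_winner_sum[OF assms(2,3)])
  qed
  then show ?thesis
    using integrable_coord_wins[OF assms(1,2)] integral_wins[OF assms(2) _ assms(1)]
    by (simp add: win_mean_def)
qed

section \<open>Expected maximum over state plus independent noise\<close>

text \<open>Choosing the term by the noise \<open>X\<close> alone makes the choice independent of
  the state, which is a function of \<open>Z\<close>. Hence each expectation of a state value times
  a selection indicator factorizes, and only the probabilities and means of the winning events
  remain.\<close>

lemma expectation_max_ge:
  fixes X :: "'k \<Rightarrow> 'a \<Rightarrow> real" and b :: "'k \<Rightarrow> ('k \<Rightarrow> real) \<Rightarrow> real"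
  assumes M: "prob_space M"
    and ind: "prob_space.indep_var M L Z (\<Pi>\<^sub>M k\<in>I. borel) (\<lambda>\<omega>. \<lambda>k\<in>I. X k \<omega>)"
    and law: "distr M (\<Pi>\<^sub>M k\<in>I. borel) (\<lambda>\<omega>. \<lambda>k\<in>I. X k \<omega>) = (\<Pi>\<^sub>M k\<in>I. \<mu>)"
    and I: "finite I" "I \<noteq> {}"
    and mean: "integrable \<mu> (\<lambda>x. x)"
    and a: "a \<in> borel_measurable L" "integrable M (\<lambda>\<omega>. a (Z \<omega>))"
    and b: "\<And>k. k \<in> I \<Longrightarrow> b k \<in> borel_measurable L" "\<And>k. k \<in> I \<Longrightarrow> integrable M (\<lambda>\<omega>. b k (Z \<omega>))"
    and int: "integrable M (\<lambda>\<omega>. max (a (Z \<omega>)) (Max ((\<lambda>k. b k (Z \<omega>) + X k \<omega>) ` I)))"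
  shows "(1 - card I * win_prob (card I)) * (\<integral>\<omega>. a (Z \<omega>) \<partial>M)
      + (\<Sum>k\<in>I. win_prob (card I) * (\<integral>\<omega>. b k (Z \<omega>) \<partial>M) + win_mean (card I))
    \<le> (\<integral>\<omega>. max (a (Z \<omega>)) (Max ((\<lambda>k. b k (Z \<omega>) + X k \<omega>) ` I)) \<partial>M)"
proof -
  interpret M: prob_space M by (rule M)
  define Y where "Y = (\<lambda>\<omega>. \<lambda>k\<in>I. X k \<omega>)"
  have Y_app: "Y \<omega> k = X k \<omega>" if "k \<in> I" for k \<omega> using that by (simp add: Y_def)
  \<comment> \<open>Independence and the joint law are given over \<open>borel\<close>, the winning
    events are integrated over \<open>\<mu>\<close>; equal sigma-algebras allow passing between the
    two.\<close>
  have sets_Y: "sets (\<Pi>\<^sub>M k\<in>I. borel) = sets (\<Pi>\<^sub>M k\<in>I. \<mu>)" by (intro sets_PiM_cong) auto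
  have ind: "M.indep_var L Z (\<Pi>\<^sub>M k\<in>I. borel) Y" using ind by (simp add: Y_def)
  have Y: "Y \<in> M \<rightarrow>\<^sub>M (\<Pi>\<^sub>M k\<in>I. borel)" using M.indep_var_rv2[OF ind] .
  have Y': "Y \<in> M \<rightarrow>\<^sub>M (\<Pi>\<^sub>M k\<in>I. \<mu>)"
    using Y by (simp add: measurable_cong_sets[OF refl sets_Y])
  have law: "distr M (\<Pi>\<^sub>M k\<in>I. \<mu>) Y = (\<Pi>\<^sub>M k\<in>I. \<mu>)"
    using law distr_cong[OF refl sets_Y, of M Y Y] by (simp add: Y_def)
  have transfer: "(\<integral>\<omega>. g (Y \<omega>) \<partial>M) = (\<integral>w. g w \<partial>(\<Pi>\<^sub>M k\<in>I. \<mu>))"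
    and transfer_int: "integrable M (\<lambda>\<omega>. g (Y \<omega>))"
    if "integrable (\<Pi>\<^sub>M k\<in>I. \<mu>) g" for g :: "('k \<Rightarrow> real) \<Rightarrow> real"
    using that integral_distr[OF Y', of g] integrable_distr[OF Y', of g] by (auto simp: law)
  have split: "(\<integral>\<omega>. c (Z \<omega>) * g (Y \<omega>) \<partial>M) = (\<integral>\<omega>. c (Z \<omega>) \<partial>M) * (\<integral>w. g w \<partial>(\<Pi>\<^sub>M k\<in>I. \<mu>))"
    and split_int: "integrable M (\<lambda>\<omega>. c (Z \<omega>) * g (Y \<omega>))"
    if c: "c \<in> borel_measurable L" "integrable M (\<lambda>\<omega>. c (Z \<omega>))"
      and g: "integrable (\<Pi>\<^sub>M k\<in>I. \<mu>) g" for c and g :: "('k \<Rightarrow> real) \<Rightarrow> real"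
  proof -
    have "g \<in> borel_measurable (\<Pi>\<^sub>M k\<in>I. borel)"
      using borel_measurable_integrable[OF g] by (simp add: measurable_cong_sets[OF sets_Y refl])
    then have "M.indep_var borel (c \<circ> Z) borel (g \<circ> Y)"
      by (intro M.indep_var_compose[OF ind] c)
    then have ind': "M.indep_var borel (\<lambda>\<omega>. c (Z \<omega>)) borel (\<lambda>\<omega>. g (Y \<omega>))"
      by (simp add: comp_def)
    show "(\<integral>\<omega>. c (Z \<omega>) * g (Y \<omega>) \<partial>M) = (\<integral>\<omega>. c (Z \<omega>) \<partial>M) * (\<integral>w. g w \<partial>(\<Pi>\<^sub>M k\<in>I. \<mu>))"
      using M.indep_var_lebesgue_integral[OF ind' c(2) transfer_int[OF g]] transfer[OF g] by simp
    show "integrable M (\<lambda>\<omega>. c (Z \<omega>) * g (Y \<omega>))"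
      by (rule M.indep_var_integrable[OF ind' c(2) transfer_int[OF g]])
  qed
  have neg_int: "integrable (\<Pi>\<^sub>M k\<in>I. \<mu>) (\<lambda>w. of_bool (\<forall>k\<in>I. w k < 0) :: real)"
    by (intro integrable_of_bool measurable_all_neg I)
  have win_int: "integrable (\<Pi>\<^sub>M k\<in>I. \<mu>) (\<lambda>w. of_bool (wins I k w) :: real)" if "k \<in> I" for k
    by (intro integrable_of_bool measurable_wins I that)
  have 1: "(\<integral>\<omega>. a (Z \<omega>) * of_bool (\<forall>k\<in>I. Y \<omega> k < 0) \<partial>M) = (1 - card I * win_prob (card I)) * (\<integral>\<omega>. a (Z \<omega>) \<partial>M)"
  proof -
    have "(\<integral>w. of_bool (\<forall>k\<in>I. w k < 0) \<partial>(\<Pi>\<^sub>M k\<in>I. \<mu>)) = 1 - card I * win_prob (card I)"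
      using integral_all_neg[OF I] by linarith
    then show ?thesis using split[OF a neg_int] by simp
  qed
  have int_1: "integrable M (\<lambda>\<omega>. a (Z \<omega>) * of_bool (\<forall>k\<in>I. Y \<omega> k < 0))"
    by (rule split_int[OF a neg_int])
  have 2: "(\<integral>\<omega>. (b k (Z \<omega>) + Y \<omega> k) * of_bool (wins I k (Y \<omega>)) \<partial>M)
      = win_prob (card I) * (\<integral>\<omega>. b k (Z \<omega>) \<partial>M) + win_mean (card I)"
    and int_2: "integrable M (\<lambda>\<omega>. (b k (Z \<omega>) + Y \<omega> k) * of_bool (wins I k (Y \<omega>)))" if k: "k \<in> I" for k
  proof -
    note p = split[OF b(1,2)[OF k] win_int[OF k]] split_int[OF b(1,2)[OF k] win_int[OF k]]
    note q = transfer[OF integrable_coord_wins[OF mean I(1) k]] transfer_int[OF integrable_coord_wins[OF mean I(1) k]]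
    have r: "(\<integral>w. w k * of_bool (wins I k w) \<partial>(\<Pi>\<^sub>M k\<in>I. \<mu>)) = win_mean (card I)"
      using integral_wins[OF I(1) k mean] by (simp add: win_mean_def)
    show "(\<integral>\<omega>. (b k (Z \<omega>) + Y \<omega> k) * of_bool (wins I k (Y \<omega>)) \<partial>M)
      = win_prob (card I) * (\<integral>\<omega>. b k (Z \<omega>) \<partial>M) + win_mean (card I)"
      unfolding distrib_right
      by (subst Bochner_Integration.integral_add[OF p(2) q(2)])
        (simp add: p(1) q(1) r integral_of_bool_wins[OF I(1) k])
    show "integrable M (\<lambda>\<omega>. (b k (Z \<omega>) + Y \<omega> k) * of_bool (wins I k (Y \<omega>)))"
      unfolding distrib_right by (rule Bochner_Integration.integrable_add[OF p(2) q(2)])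
  qed
  have int_sum: "integrable M (\<lambda>\<omega>. \<Sum>k\<in>I. (b k (Z \<omega>) + Y \<omega> k) * of_bool (wins I k (Y \<omega>)))"
    using int_2 by (intro Bochner_Integration.integrable_sum) auto
  \<comment> \<open>Ties are null under the product law; pulling this back along \<open>Y\<close>
    makes the pointwise bound available almost surely on \<open>M\<close>.\<close>
  have "AE w in distr M (\<Pi>\<^sub>M k\<in>I. \<mu>) Y. inj_on w I"
    unfolding law by (rule AE_inj_on[OF I(1)])
  then have "AE \<omega> in M. inj_on (Y \<omega>) I" by (rule AE_distrD[OF Y'])
  then have le: "AE \<omega> in M. a (Z \<omega>) * of_bool (\<forall>k\<in>I. Y \<omega> k < 0)
       + (\<Sum>k\<in>I. (b k (Z \<omega>) + Y \<omega> k) * of_bool (wins I k (Y \<omega>)))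
      \<le> max (a (Z \<omega>)) (Max ((\<lambda>k. b k (Z \<omega>) + X k \<omega>) ` I))"
  proof eventually_elim
    case (elim \<omega>)
    have "(\<lambda>k. b k (Z \<omega>) + Y \<omega> k) ` I = (\<lambda>k. b k (Z \<omega>) + X k \<omega>) ` I"
      using Y_app by (intro image_cong) auto
    then show ?case
      using max_ge_winner_sum[OF I elim, of "a (Z \<omega>)" "\<lambda>k. b k (Z \<omega>) + Y \<omega> k"] by (simp only:)
  qed
  have "(1 - card I * win_prob (card I)) * (\<integral>\<omega>. a (Z \<omega>) \<partial>M)
      + (\<Sum>k\<in>I. win_prob (card I) * (\<integral>\<omega>. b k (Z \<omega>) \<partial>M) + win_mean (card I))
    = (\<integral>\<omega>. a (Z \<omega>) * of_bool (\<forall>k\<in>I. Y \<omega> k < 0)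
       + (\<Sum>k\<in>I. (b k (Z \<omega>) + Y \<omega> k) * of_bool (wins I k (Y \<omega>))) \<partial>M)"
    unfolding Bochner_Integration.integral_add[OF int_1 int_sum] 1
    by (subst Bochner_Integration.integral_sum) (simp_all add: int_2 2 cong: sum.cong)
  also have "\<dots> \<le> (\<integral>\<omega>. max (a (Z \<omega>)) (Max ((\<lambda>k. b k (Z \<omega>) + X k \<omega>) ` I)) \<partial>M)"
    by (intro integral_mono_AE Bochner_Integration.integrable_add int_1 int_sum int le)
  finally show ?thesis .
qed

end

section \<open>The process as a functional of past noise\<close>

text \<open>One step at time \<open>t\<close> reads noise with index \<open>t\<close>, so the state
  at time \<open>t\<close> involves strictly earlier noise. The points \<open>\<omega>\<close> and
  \<open>\<omega>'\<close> may lie in different sample spaces, which allows a comparison with the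
  process run on coordinate maps.\<close>

lemma max_process_cong:
  assumes "\<And>i j s. (i, j) \<in> parcs G \<Longrightarrow> s < t \<Longrightarrow> v i j s \<omega> = v' i j s \<omega>'"
  shows "max_process G x0 v t i \<omega> = max_process G x0 v' t i \<omega>'"
  using assms
proof (induction t arbitrary: i)
  case (Suc t)
  have IH: "max_process G x0 v t k \<omega> = max_process G x0 v' t k \<omega>'" for k
    using Suc by simp
  have "(\<lambda>j. max_process G x0 v t j \<omega> + v i j t \<omega>) ` neighbors G i
      = (\<lambda>j. max_process G x0 v' t j \<omega>' + v' i j t \<omega>') ` neighbors G i"
    using Suc.prems[of i _ t] by (intro image_cong refl) (simp add: IH neighbors_def)
  then show ?case by (simp add: IH)
qed simp

text \<open>Measurability is required on arcs and before time \<open>t\<close> only, because the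
  coordinate maps of the past noise are available just there.\<close>

lemma measurable_max_process:
  assumes "\<And>i. finite (neighbors G i)"
    and "\<And>i j s. (i, j) \<in> parcs G \<Longrightarrow> s < t \<Longrightarrow> v i j s \<in> borel_measurable M"
  shows "max_process G x0 v t i \<in> borel_measurable M"
  using assms(2)
proof (induction t arbitrary: i)
  case (Suc t)
  have IH: "max_process G x0 v t k \<in> borel_measurable M" for k
    using Suc by simp
  have "(\<lambda>\<omega>. Max ((\<lambda>j. max_process G x0 v t j \<omega> + v i j t \<omega>) ` neighbors G i)) \<in> borel_measurable M"
    using Suc.prems by (intro borel_measurable_Max assms(1) borel_measurable_add IH) (auto simp: neighbors_def)
  then show ?case using IH by simp
qed simp

lemma integrable_Max:
  fixes f :: "'i \<Rightarrow> 'a \<Rightarrow> real"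
  assumes "finite I" "I \<noteq> {}" "\<And>i. i \<in> I \<Longrightarrow> integrable M (f i)"
  shows "integrable M (\<lambda>x. Max ((\<lambda>i. f i x) ` I))"
  using assms by (induction I rule: finite_ne_induct) auto

lemma integrable_max_process:
  assumes M: "finite_measure M"
    and graph: "\<And>i. finite (neighbors G i)" "\<And>i. i \<in> pverts G \<Longrightarrow> neighbors G i \<noteq> {}"
      "\<And>i. neighbors G i \<subseteq> pverts G"
    and int: "\<And>i j t. (i, j) \<in> parcs G \<Longrightarrow> integrable M (v i j t)"
    and i: "i \<in> pverts G"
  shows "integrable M (max_process G x0 v t i)"
  using i
proof (induction t arbitrary: i)
  case 0
  then show ?case using finite_measure.integrable_const[OF M] by simp
next
  case (Suc t)
  have "integrable M (\<lambda>\<omega>. Max ((\<lambda>j. max_process G x0 v t j \<omega> + v i j t \<omega>) ` neighbors G i))"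
  proof (intro integrable_Max Bochner_Integration.integrable_add)
    fix j assume j: "j \<in> neighbors G i"
    show "integrable M (max_process G x0 v t j)" using j graph(3) by (intro Suc.IH) auto
    show "integrable M (v i j t)" using j int by (simp add: neighbors_def)
  qed (use graph Suc.prems in auto)
  then show ?case using Suc by simp
qed

text \<open>Double counting: by symmetry of adjacency, the value at \<open>j\<close> is counted once
  for each of the \<open>d\<close> neighbors of \<open>j\<close>.\<close>

lemma sum_over_neighbors:
  fixes g :: "'v \<Rightarrow> real"
  assumes G: "pair_graph G" and reg: "regular_graph G d"
  shows "(\<Sum>i\<in>pverts G. \<Sum>j\<in>neighbors G i. g j) = d * (\<Sum>i\<in>pverts G. g i)"
proof -
  interpret pair_graph G by (rule G)
  have sym: "j \<in> neighbors G i \<longleftrightarrow> i \<in> neighbors G j" for i j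
    using pair_sym_arcs by (auto simp: neighbors_def symmetric_def sym_def)
  have sub: "neighbors G i \<subseteq> pverts G" for i by (auto simp: neighbors_def dest: in_arcsD2)
  have "(\<Sum>i\<in>pverts G. \<Sum>j\<in>neighbors G i. g j) = (\<Sum>i\<in>pverts G. \<Sum>j | j \<in> pverts G \<and> j \<in> neighbors G i. g j)"
    using sub by (intro sum.cong refl) auto
  also have "\<dots> = (\<Sum>j\<in>pverts G. \<Sum>i | i \<in> pverts G \<and> j \<in> neighbors G i. g j)"
    by (rule sum.swap_restrict) (rule pair_finite_verts)+
  also have "\<dots> = (\<Sum>j\<in>pverts G. \<Sum>i\<in>neighbors G j. g j)"
    using sub sym by (intro sum.cong refl) auto
  also have "\<dots> = d * (\<Sum>i\<in>pverts G. g i)"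
    using reg by (simp add: regular_graph_def sum_distrib_left)
  finally show ?thesis .
qed

section \<open>Growth of the total expectation\<close>

context atomless_law
begin

lemma max_process_drift:
  fixes v :: "'v \<Rightarrow> 'v \<Rightarrow> nat \<Rightarrow> 'a \<Rightarrow> real"
  assumes G: "pair_graph G" and reg: "regular_graph G d" "d \<ge> 1"
    and M: "prob_space M"
    and indep: "prob_space.indep_vars M (\<lambda>_. borel) (\<lambda>((i, j), t). v i j t) (parcs G \<times> UNIV)"
    and law: "\<And>i j t. (i, j) \<in> parcs G \<Longrightarrow> distr M borel (v i j t) = \<mu>"
    and int: "\<And>i j t. (i, j) \<in> parcs G \<Longrightarrow> integrable M (v i j t)"
    and mean: "integrable \<mu> (\<lambda>x. x)"
    and i: "i \<in> pverts G"
  shows "(1 - d * win_prob d) * (\<integral>\<omega>. max_process G x0 v t i \<omega> \<partial>M)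
      + (\<Sum>j\<in>neighbors G i. win_prob d * (\<integral>\<omega>. max_process G x0 v t j \<omega> \<partial>M) + win_mean d)
    \<le> (\<integral>\<omega>. max_process G x0 v (Suc t) i \<omega> \<partial>M)"
proof -
  interpret G: pair_graph G by (rule G)
  interpret M: prob_space M by (rule M)
  have fin: "finite (neighbors G i)" and sub: "neighbors G i \<subseteq> pverts G" for i
  proof -
    show sub: "neighbors G i \<subseteq> pverts G" by (auto simp: neighbors_def dest: G.in_arcsD2)
    show "finite (neighbors G i)" by (rule finite_subset[OF sub G.pair_finite_verts])
  qed
  have ne: "neighbors G i \<noteq> {}" if "i \<in> pverts G" for i
    using reg that by (auto simp: regular_graph_def)
  define X where "X = (\<lambda>((i, j), t). v i j t)"
  \<comment> \<open>The past consists of all arcs, since the states depend on noise throughout the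
    graph. Excluding time \<open>t\<close> makes it disjoint from the current indices
    \<open>I\<close>, hence independent of them.\<close>
  define A where "A = parcs G \<times> {..<t}"
  \<comment> \<open>The neighbors are renamed to the noise indices they use at time
    \<open>t\<close>; \<open>snd (fst k)\<close> recovers the neighbor.\<close>
  define arc where "arc = (\<lambda>j::'v. ((i, j), t))"
  define I where "I = arc ` neighbors G i"
  have inj: "inj_on arc (neighbors G i)" by (auto simp: arc_def inj_on_def)
  have X_arc: "X (arc j) = v i j t" for j by (simp add: X_def arc_def)
  have I: "finite I" "I \<noteq> {}" "card I = d"
    using fin ne[OF i] reg i card_image[OF inj] by (auto simp: I_def regular_graph_def)
  have I_sub: "I \<subseteq> parcs G \<times> UNIV" by (auto simp: I_def arc_def neighbors_def)
  have indep': "M.indep_vars (\<lambda>_. borel) X (parcs G \<times> UNIV)" using indep by (simp add: X_def)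
  have rv: "X k \<in> borel_measurable M" if "k \<in> parcs G \<times> UNIV" for k
    using int that by (auto simp: X_def)
  have past_now: "M.indep_var (\<Pi>\<^sub>M k\<in>A. borel) (\<lambda>\<omega>. \<lambda>k\<in>A. X k \<omega>) (\<Pi>\<^sub>M k\<in>I. borel) (\<lambda>\<omega>. \<lambda>k\<in>I. X k \<omega>)"
    using indep' I_sub by (intro M.indep_var_restrict) (auto simp: A_def I_def arc_def)
  have joint: "distr M (\<Pi>\<^sub>M k\<in>I. borel) (\<lambda>\<omega>. \<lambda>k\<in>I. X k \<omega>) = (\<Pi>\<^sub>M k\<in>I. \<mu>)"
  proof -
    have "distr M (\<Pi>\<^sub>M k\<in>I. borel) (\<lambda>\<omega>. \<lambda>k\<in>I. X k \<omega>) = (\<Pi>\<^sub>M k\<in>I. distr M borel (X k))"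
      using M.indep_vars_iff_distr_eq_PiM'[OF I(2), where X = X and M' = "\<lambda>_. borel"] rv I_sub M.indep_vars_subset[OF indep' I_sub]
      by blast
    also have "\<dots> = (\<Pi>\<^sub>M k\<in>I. \<mu>)"
      using law I_sub by (intro PiM_cong refl) (auto simp: X_def)
    finally show ?thesis .
  qed
  \<comment> \<open>The state at time \<open>t\<close> as a deterministic function of the past noise: the process run on coordinate maps.\<close>
  define x where "x = (\<lambda>j. max_process G x0 (\<lambda>i j s w. w ((i, j), s)) t j)"
  have x: "x j (\<lambda>k\<in>A. X k \<omega>) = max_process G x0 v t j \<omega>" for j \<omega>
    unfolding x_def by (rule max_process_cong) (simp add: A_def X_def)
  have x_meas: "x j \<in> borel_measurable (\<Pi>\<^sub>M k\<in>A. borel)" for j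
    unfolding x_def
    by (intro measurable_max_process fin measurable_component_singleton) (auto simp: A_def)
  have x_int: "integrable M (\<lambda>\<omega>. x j (\<lambda>k\<in>A. X k \<omega>))" if "j \<in> pverts G" for j
    unfolding x using that
    by (intro integrable_max_process fin ne sub int M.finite_measure_axioms)
  have step: "max_process G x0 v (Suc t) i = (\<lambda>\<omega>. max (x i (\<lambda>k\<in>A. X k \<omega>))
      (Max ((\<lambda>k. x (snd (fst k)) (\<lambda>k\<in>A. X k \<omega>) + X k \<omega>) ` I)))"
    unfolding x I_def image_image X_arc by (simp add: arc_def)
  have step_int: "integrable M (max_process G x0 v (Suc t) i)"
    by (intro integrable_max_process fin ne sub int M.finite_measure_axioms i)
  have I_verts: "snd (fst k) \<in> pverts G" if "k \<in> I" for k
    using that sub[of i] by (auto simp: I_def arc_def)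
  have "(1 - card I * win_prob (card I)) * (\<integral>\<omega>. x i (\<lambda>k\<in>A. X k \<omega>) \<partial>M)
      + (\<Sum>k\<in>I. win_prob (card I) * (\<integral>\<omega>. x (snd (fst k)) (\<lambda>k\<in>A. X k \<omega>) \<partial>M) + win_mean (card I))
    \<le> (\<integral>\<omega>. max (x i (\<lambda>k\<in>A. X k \<omega>))
      (Max ((\<lambda>k. x (snd (fst k)) (\<lambda>k\<in>A. X k \<omega>) + X k \<omega>) ` I)) \<partial>M)"
    by (intro expectation_max_ge[OF M past_now joint I(1,2) mean] x_meas x_int i I_verts
        step_int[unfolded step])
  then show ?thesis
    unfolding step x I(3) unfolding I_def
    by (subst (asm) sum.reindex[OF inj]) (simp add: arc_def)
qed

text \<open>The drift bound at one vertex involves its neighbors and does not iterate by itself. Its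
  sum over all vertices closes up, so the induction runs on the total.\<close>

lemma sum_max_process_ge:
  fixes v :: "'v \<Rightarrow> 'v \<Rightarrow> nat \<Rightarrow> 'a \<Rightarrow> real"
  assumes G: "pair_graph G" and reg: "regular_graph G d" "d \<ge> 1"
    and M: "prob_space M"
    and indep: "prob_space.indep_vars M (\<lambda>_. borel) (\<lambda>((i, j), t). v i j t) (parcs G \<times> UNIV)"
    and law: "\<And>i j t. (i, j) \<in> parcs G \<Longrightarrow> distr M borel (v i j t) = \<mu>"
    and int: "\<And>i j t. (i, j) \<in> parcs G \<Longrightarrow> integrable M (v i j t)"
    and mean: "integrable \<mu> (\<lambda>x. x)"
  shows "(\<Sum>i\<in>pverts G. x0 i) + t * (card (pverts G) * (d * win_mean d))
    \<le> (\<Sum>i\<in>pverts G. \<integral>\<omega>. max_process G x0 v t i \<omega> \<partial>M)"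
proof (induction t)
  case 0
  interpret M: prob_space M by (rule M)
  show ?case by (simp add: M.prob_space)
next
  case (Suc t)
  define e where "e i = (\<integral>\<omega>. max_process G x0 v t i \<omega> \<partial>M)" for i
  have "(\<Sum>i\<in>pverts G. (1 - d * win_prob d) * e i + (\<Sum>j\<in>neighbors G i. win_prob d * e j + win_mean d))
      \<le> (\<Sum>i\<in>pverts G. \<integral>\<omega>. max_process G x0 v (Suc t) i \<omega> \<partial>M)"
    unfolding e_def by (intro sum_mono max_process_drift assms)
  also have "(\<Sum>i\<in>pverts G. (1 - d * win_prob d) * e i + (\<Sum>j\<in>neighbors G i. win_prob d * e j + win_mean d))
     = (1 - d * win_prob d) * (\<Sum>i\<in>pverts G. e i)
       + win_prob d * (\<Sum>i\<in>pverts G. \<Sum>j\<in>neighbors G i. e j) + card (pverts G) * (d * win_mean d)"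
    using reg by (simp add: sum.distrib sum_distrib_left regular_graph_def)
  \<comment> \<open>The double sum is \<open>d\<close> times the total, so the
    \<open>win_prob d\<close> terms cancel and the probability disappears from the
    recursion.\<close>
  also have "\<dots> = (\<Sum>i\<in>pverts G. e i) + card (pverts G) * (d * win_mean d)"
    by (simp add: sum_over_neighbors[OF G reg(1)] algebra_simps)
  finally show ?case using Suc by (simp add: e_def algebra_simps)
qed

end

section \<open>Passage to the growth rate\<close>

lemma atomless_law_density:
  assumes [measurable]: "f \<in> borel_measurable borel" and "prob_space (density lborel f)"
  shows "atomless_law (density lborel f)"
proof -
  interpret prob_space "density lborel f" by (rule assms(2))
  have "emeasure (density lborel f) {x} = 0" for x
    by (subst emeasure_density) (auto simp: nn_integral_indicator_singleton)
  then show ?thesis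
    by unfold_locales (auto simp: measure_def)
qed

theorem mainTheorem4:
  fixes G :: "nat pair_pre_digraph"
    and N d :: nat
    and M :: "'a measure"
    and v :: "nat \<Rightarrow> nat \<Rightarrow> nat \<Rightarrow> 'a \<Rightarrow> real"
    and F f :: "real \<Rightarrow> real"
    and x0 :: "nat \<Rightarrow> real"
    and lam :: real
  assumes graph: "pair_graph G" "pverts G = {1..N}"
    and connected: "Digraph_Component.connected (with_proj G)"
    and regular: "regular_graph G d" "d \<ge> 1"
    and prob: "prob_space M"
    and indep: "prob_space.indep_vars M (\<lambda>_. borel) (\<lambda>((i, j), t). v i j t) (parcs G \<times> UNIV)"
    and pdf_nonneg: "\<And>x. f x \<ge> 0"
    and pdf: "\<And>i j t. (i, j) \<in> parcs G \<Longrightarrow> distributed M lborel (v i j t) (\<lambda>x. ennreal (f x))"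
    and cdf: "\<And>i j t. (i, j) \<in> parcs G \<Longrightarrow> cdf (distr M borel (v i j t)) = F"
    and zero_mean: "\<And>i j t. (i, j) \<in> parcs G \<Longrightarrow>
          integrable M (v i j t) \<and> prob_space.expectation M (v i j t) = 0"
    and growth: "growth_rate M {1..N} (max_process G x0 v) lam"
  shows "lam \<ge> m_plus (density lborel (\<lambda>x. ennreal (f x))) d
    \<and> m_plus (density lborel (\<lambda>x. ennreal (f x))) d
        = real d * (LBINT x:{0..}. x * F x ^ (d - 1) * f x)"
proof -
  interpret G: pair_graph G by (rule graph)
  interpret M: prob_space M by (rule prob)
  define \<mu> where "\<mu> = density lborel (\<lambda>x. ennreal (f x))"
  \<comment> \<open>Connectedness includes having a vertex, and positive degree then gives an arc.
    Its noise variable transfers the assumptions on \<open>F\<close> and \<open>f\<close>, which are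
    stated per arc, to the law \<open>\<mu>\<close>.\<close>
  have "pverts G \<noteq> {}"
    using connected
    by (simp add: Digraph_Component.connected_def strongly_connected_def mk_symmetric_def)
  then obtain i j where ij: "(i, j) \<in> parcs G"
    using regular by (force simp: regular_graph_def neighbors_def)
  have N: "N > 0" using \<open>pverts G \<noteq> {}\<close> graph(2) by (cases N) auto
  have law: "distr M borel (v i j t) = \<mu>" if "(i, j) \<in> parcs G" for i j t
  proof -
    have "distr M borel (v i j t) = distr M lborel (v i j t)" by (rule distr_cong) auto
    then show ?thesis using pdf[OF that] by (simp add: distributed_def \<mu>_def)
  qed
  have f_ennreal: "(\<lambda>x. ennreal (f x)) \<in> borel_measurable borel"
    using pdf[OF ij] by (simp add: distributed_def)
  \<comment> \<open>The density assumption yields measurability of \<open>ennreal (f x)\<close>;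
    nonnegativity of \<open>f\<close> lets \<open>enn2real\<close> recover \<open>f\<close>
    itself.\<close>
  have f_meas [measurable]: "f \<in> borel_measurable borel"
    using borel_measurable_enn2real[OF f_ennreal] pdf_nonneg by simp
  have v_meas: "v i j t \<in> borel_measurable M" if "(i, j) \<in> parcs G" for t i j
    using zero_mean[OF that] by auto
  have "prob_space \<mu>"
    using M.prob_space_distr[OF v_meas[OF ij]] law[OF ij] by simp
  then interpret atomless_law \<mu>
    unfolding \<mu>_def by (rule atomless_law_density[OF f_ennreal])
  have mean: "integrable \<mu> (\<lambda>x. x)"
    using zero_mean[OF ij] law[OF ij] integrable_distr_eq[OF v_meas[OF ij, of 0], of "\<lambda>x. x"] by simp
  have F: "F = Distribution_Functions.cdf \<mu>" using cdf[OF ij] law[OF ij] by simp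
  have m_plus: "m_plus \<mu> d = d * win_mean d"
    using integral_Max[OF mean, of "{1..d}"] regular(2) by (simp add: m_plus_def)
  have F_meas [measurable]: "F \<in> borel_measurable borel" unfolding F by (rule cdf_measurable)
  have "win_mean d = (\<integral>x. f x *\<^sub>R (x * indicator {0..} x * F x ^ (d - 1)) \<partial>lborel)"
    unfolding win_mean_def F[symmetric] unfolding \<mu>_def
    by (rule integral_density) (auto simp: pdf_nonneg)
  also have "\<dots> = (LBINT x:{0..}. x * F x ^ (d - 1) * f x)"
    unfolding set_lebesgue_integral_def by (simp add: mult_ac)
  finally have formula: "win_mean d = (LBINT x:{0..}. x * F x ^ (d - 1) * f x)" .
  \<comment> \<open>After division by \<open>t\<close> the initial values carry weight
    \<open>1/t\<close> and vanish in the limit. The restriction \<open>t \<ge> 1\<close> keeps the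
    division genuine.\<close>
  have bound: "(\<Sum>i\<in>pverts G. x0 i) / t + N * (d * win_mean d)
      \<le> (\<Sum>i\<in>{1..N}. (\<integral>\<omega>. max_process G x0 v t i \<omega> \<partial>M) / t)" if "t \<ge> 1" for t :: nat
  proof -
    have "((\<Sum>i\<in>pverts G. x0 i) + t * (N * (d * win_mean d))) / t
      \<le> (\<Sum>i\<in>pverts G. \<integral>\<omega>. max_process G x0 v t i \<omega> \<partial>M) / t"
      using sum_max_process_ge[OF graph(1) regular prob indep law _ mean, of x0 t] zero_mean graph(2)
      by (intro divide_right_mono) auto
    then show ?thesis using that graph(2) by (simp add: add_divide_distrib sum_divide_distrib)
  qed
  have "(\<lambda>t. (\<Sum>i\<in>pverts G. x0 i) / real t + N * (d * win_mean d)) \<longlonglongrightarrow> 0 + N * (d * win_mean d)"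
    by (intro tendsto_add tendsto_const lim_const_over_n)
  \<comment> \<open>All vertices share the limit \<open>lam\<close>, so the sum tends to
    \<open>N\<close> times \<open>lam\<close> and the factor \<open>N > 0\<close> cancels from the
    comparison of limits.\<close>
  moreover have "(\<lambda>t. \<Sum>i\<in>{1..N}. (\<integral>\<omega>. max_process G x0 v t i \<omega> \<partial>M) / real t) \<longlonglongrightarrow> (\<Sum>i\<in>{1..N}. lam)"
    using growth by (intro tendsto_sum) (auto simp: growth_rate_def)
  ultimately have "0 + N * (d * win_mean d) \<le> (\<Sum>i\<in>{1..N}. lam)"
    using bound by (intro LIMSEQ_le) auto
  then have "d * win_mean d \<le> lam" using N by simp
  then show ?thesis using m_plus formula by (simp add: \<mu>_def)
qed

end
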